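(* Let $G$ be a connected, triangle-free graph with domination number $\gamma(G)\le 3$. Then $G$ is well-dominated if and only if $G$ is isomorphic to one of the eleven graphs $K_1$, $K_2$, $P_4$, $C_4$, $C_5$, $C_7$, $P_3\circ K_1$, $H_1$, $H_2$, $H_3$, $H_4$.
   Context: All graphs are finite and simple. A set $D\subseteq V(G)$ is a dominating set of $G$ if every vertex of $G$ is in $D$ or adjacent to a vertex of $D$. The domination number $\gamma(G)$ is the minimum cardinality of a dominating set. A graph is well-dominated if all of its minimal (with respect to inclusion) dominating sets have the same cardinality. $P_n$, $C_n$, $K_n$ denote the path, cycle and complete graph on $n$ vertices. The corona $F\circ K_1$ is formed from $F$ by adding, for each vertex of $F$, a single new vertex of degree $1$ adjacent to it. The graphs $H_1,\dots,H_4$ have vertex set $\{1,\dots,7\}$ and edge sets: $E(H_1)=\{12,13,25,36,56,47,67\}$ (a $5$-cycle with a pendant path of length $2$ attached); $E(H_2)=E(H_1)\cup\{17\}$; $E(H_3)=E(H_1)\cup\{34\}$ (a $5$-cycle and a $4$-cycle sharing exactly one edge); $E(H_4)=E(H_1)\cup\{34,17\}$. *)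

theory Defs
  imports "Graph_Theory.Graph_Theory"
begin

text \<open>
  A finite simple graph is a \<^locale>\<open>pair_graph\<close>: an undirected edge \<open>uv\<close> is represented by the
  two arcs \<open>(u, v)\<close> and \<open>(v, u)\<close>.
\<close>

definition graph_of_edges :: "'a set \<Rightarrow> 'a set set \<Rightarrow> 'a pair_pre_digraph" where
  "graph_of_edges V E = \<lparr> pverts = V, parcs = {(u, v). {u, v} \<in> E} \<rparr>"

lemma pair_graph_graph_of_edges:
  assumes "finite V" and "\<And>e. e \<in> E \<Longrightarrow> e \<subseteq> V \<and> card e = 2"
  shows "pair_graph (graph_of_edges V E)"
proof -
  have mem: "u \<in> V \<and> v \<in> V \<and> u \<noteq> v" if "{u, v} \<in> E" for u v
    using assms(2)[OF that] by (cases "u = v") auto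
  have "finite {(u, v). {u, v} \<in> E}"
    by (rule finite_subset[of _ "V \<times> V"]) (use mem assms(1) in auto)
  then show ?thesis
    using assms(1)
    by unfold_locales
      (auto simp: graph_of_edges_def symmetric_def insert_commute intro: symI dest: mem)
qed

definition triangle_free :: "'a pair_pre_digraph \<Rightarrow> bool" where
  "triangle_free G \<longleftrightarrow>
    \<not> (\<exists>u v w. (u, v) \<in> parcs G \<and> (v, w) \<in> parcs G \<and> (w, u) \<in> parcs G)"

definition dominating_set :: "'a pair_pre_digraph \<Rightarrow> 'a set \<Rightarrow> bool" where
  "dominating_set G D \<longleftrightarrow>
    D \<subseteq> pverts G \<and> (\<forall>v\<in>pverts G. v \<in> D \<or> (\<exists>u\<in>D. (u, v) \<in> parcs G))"

definition domination_number :: "'a pair_pre_digraph \<Rightarrow> nat" where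
  "domination_number G = Min (card ` {D. dominating_set G D})"

definition minimal_dominating_set :: "'a pair_pre_digraph \<Rightarrow> 'a set \<Rightarrow> bool" where
  "minimal_dominating_set G D \<longleftrightarrow>
    dominating_set G D \<and> (\<forall>D'. D' \<subset> D \<longrightarrow> \<not> dominating_set G D')"

definition well_dominated :: "'a pair_pre_digraph \<Rightarrow> bool" where
  "well_dominated G \<longleftrightarrow>
    (\<forall>D D'. minimal_dominating_set G D \<longrightarrow> minimal_dominating_set G D' \<longrightarrow> card D = card D')"

definition complete_graph :: "nat \<Rightarrow> nat pair_pre_digraph" where
  "complete_graph n = graph_of_edges {..<n} {{i, j} | i j. i < n \<and> j < n \<and> i \<noteq> j}"

lemma complete_digraph_complete_graph: "complete_digraph n (with_proj (complete_graph n))"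
proof -
  have "pair_graph (complete_graph n)"
    unfolding complete_graph_def by (rule pair_graph_graph_of_edges) auto
  then interpret pair_graph "complete_graph n" .
  show ?thesis
    unfolding complete_digraph_def
    using graph_axioms
    by (auto simp: complete_graph_def graph_of_edges_def doubleton_eq_iff)
qed

definition path_graph :: "nat \<Rightarrow> nat pair_pre_digraph" where
  "path_graph n = graph_of_edges {..<n} {{i, Suc i} | i. Suc i < n}"

text \<open>The next definition yields the cycle only for \<open>n \<ge> 3\<close>.\<close>

definition cycle_graph :: "nat \<Rightarrow> nat pair_pre_digraph" where
  "cycle_graph n = graph_of_edges {..<n} {{i, Suc i mod n} | i. i < n}"

text \<open>\<open>Inl v\<close> is the vertex \<open>v\<close> of \<open>F\<close>; \<open>Inr v\<close> is the new leaf attached to it.\<close>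

definition corona_K1 :: "'a pair_pre_digraph \<Rightarrow> ('a + 'a) pair_pre_digraph" where
  "corona_K1 F = graph_of_edges (Inl ` pverts F \<union> Inr ` pverts F)
    ({{Inl u, Inl v} | u v. (u, v) \<in> parcs F} \<union> {{Inl v, Inr v} | v. v \<in> pverts F})"

definition H1_edges :: "nat set set" where
  "H1_edges = {{1,2}, {1,3}, {2,5}, {3,6}, {5,6}, {4,7}, {6,7}}"

definition H1 :: "nat pair_pre_digraph" where
  "H1 = graph_of_edges {1..7} H1_edges"

definition H2 :: "nat pair_pre_digraph" where
  "H2 = graph_of_edges {1..7} (H1_edges \<union> {{1,7}})"

definition H3 :: "nat pair_pre_digraph" where
  "H3 = graph_of_edges {1..7} (H1_edges \<union> {{3,4}})"

definition H4 :: "nat pair_pre_digraph" where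
  "H4 = graph_of_edges {1..7} (H1_edges \<union> {{3,4}, {1,7}})"

definition isomorphic :: "'a pair_pre_digraph \<Rightarrow> 'b pair_pre_digraph \<Rightarrow> bool"
    (infix \<open>\<simeq>\<close> 50) where
  "G \<simeq> H \<longleftrightarrow> digraph_iso (with_proj G) (with_proj H)"

end

theory Submission
  imports Defs
begin

text \<open>
  A maximal independent set is a minimal dominating set, so in a well-dominated graph with
  domination number at most 3 every independent set has at most 3 vertices. Triangle-free graphs
  with this property have at most 8 vertices, because \<open>R(3,4) = 9\<close>, and the property is inherited
  by induced subgraphs. Hence all of them are obtained by adding one vertex at a time, discarding
  isomorphic copies. This yields 48 graphs, and it remains to evaluate domination and
  connectedness for each of them.
\<close>

section \<open>Triangular adjacency matrices\<close>

text \<open>Neither connectedness nor well-domination passes to induced subgraphs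
  (\<open>P_3\<close> inside \<open>P_4\<close>), so they cannot prune the generation; both are
  tested only on the finished lists, which contain disconnected graphs as well. The Ramsey bound is
  not an input: the ninth generation is computed and turns out empty. Correctness rests on
  completeness alone: the filters never reject an admissible graph, and two matrices are identified
  only if a relabelling carries one to the other; a missed identification would merely leave
  duplicates. Strictly triangular matrices turn the addition of a vertex into a list cons, leaving
  all older rows untouched.\<close>

fun rows :: "('v \<Rightarrow> 'v \<Rightarrow> bool) \<Rightarrow> 'v list \<Rightarrow> bool list list" where
  "rows A [] = []"
| "rows A (x # xs) = map (A x) xs # rows A xs"

text \<open>One graph realises many matrices, one for each ordering of \<open>V\<close>; for
  symmetric irreflexive \<open>A\<close> any single one fixes the graph up to isomorphism.\<close>

definition realises :: "'v set \<Rightarrow> ('v \<Rightarrow> 'v \<Rightarrow> bool) \<Rightarrow> bool list list \<Rightarrow> bool" where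
  "realises V A M \<longleftrightarrow> (\<exists>xs. distinct xs \<and> set xs = V \<and> rows A xs = M)"

abbreviation adj :: "'a pair_pre_digraph \<Rightarrow> 'a \<Rightarrow> 'a \<Rightarrow> bool" where
  "adj G u v \<equiv> (u, v) \<in> parcs G"

text \<open>The full symmetric matrix, with \<open>True\<close> on the diagonal: its rows are closed neighbourhoods.\<close>

fun closed_matrix :: "bool list list \<Rightarrow> bool list list" where
  "closed_matrix [] = []"
| "closed_matrix (r # M) = (True # r) # map2 (#) r (closed_matrix M)"

lemma length_rows [simp]: "length (rows A xs) = length xs"
  by (induction xs) auto

lemma rows_cong:
  "(\<And>u v. u \<in> set xs \<Longrightarrow> v \<in> set xs \<Longrightarrow> A u v = B u v) \<Longrightarrow> rows A xs = rows B xs"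
  by (induction xs) auto

lemma rows_map: "rows A (map f xs) = rows (\<lambda>u v. A (f u) (f v)) xs"
  by (induction xs) auto

lemma rows_eqD:
  assumes "rows A xs = rows B ys" "j < length xs" "i < j"
  shows "A (xs ! i) (xs ! j) = B (ys ! i) (ys ! j)"
  using assms
proof (induction xs arbitrary: ys i j)
  case (Cons x xs)
  then obtain y ys' where ys: "ys = y # ys'"
    by (metis length_rows length_Suc_conv length_Cons)
  from Cons.prems have *: "map (A x) xs = map (B y) ys'" "rows A xs = rows B ys'"
    by (auto simp: ys)
  obtain j' where j: "j = Suc j'" "j' < length xs"
    using Cons.prems by (cases j) auto
  have len: "length ys' = length xs"
    using *(2) by (metis length_rows)
  show ?case
  proof (cases i)
    case 0
    have "map (A x) xs ! j' = map (B y) ys' ! j'"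
      using *(1) by simp
    then show ?thesis using 0 j len by (simp add: ys)
  next
    case (Suc i')
    then show ?thesis
      using Cons.IH[OF *(2), of j' i'] Cons.prems j by (simp add: ys)
  qed
qed simp

lemma closed_matrix_rows:
  assumes "symp A" "distinct xs"
  shows "closed_matrix (rows A xs) = map (\<lambda>x. map (\<lambda>y. y = x \<or> A x y) xs) xs"
  using assms(2)
proof (induction xs)
  case (Cons x xs)
  \<comment> \<open>Symmetry lets the row of \<open>x\<close> double as the column in front of the
    other rows; distinctness keeps that column off the diagonal.\<close>
  have "map2 (#) (map (A x) xs) (map (\<lambda>u. map (\<lambda>y. y = u \<or> A u y) xs) xs) =
      map (\<lambda>u. map (\<lambda>y. y = u \<or> A u y) (x # xs)) xs"
    using Cons.prems sympD[OF assms(1)]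
    by (auto simp: map2_map_map)
  then show ?case
    using Cons by auto
qed simp

section \<open>Generating graphs up to isomorphism\<close>

fun stable_mask :: "bool list \<Rightarrow> bool list list \<Rightarrow> bool" where
  "stable_mask (b # bs) (r # M) \<longleftrightarrow> (b \<longrightarrow> list_all2 (\<lambda>c e. \<not> (c \<and> e)) bs r) \<and> stable_mask bs M"
| "stable_mask _ _ \<longleftrightarrow> True"

fun has_stable :: "nat \<Rightarrow> bool list \<Rightarrow> bool list list \<Rightarrow> bool" where
  "has_stable 0 _ _ \<longleftrightarrow> True"
| "has_stable (Suc k) (b # bs) (r # M) \<longleftrightarrow>
    b \<and> has_stable k (map2 (\<lambda>c e. c \<and> \<not> e) bs r) M \<or> has_stable (Suc k) bs M"
| "has_stable (Suc k) _ _ \<longleftrightarrow> False"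

abbreviation masks :: "nat \<Rightarrow> bool list list" where
  "masks n \<equiv> List.n_lists n [True, False]"

text \<open>A stable neighbourhood means no triangle through the new vertex. The 3 arises because a
  stable triple of non-neighbours and the new vertex would form a stable set of size 4.\<close>

definition extensions :: "bool list list \<Rightarrow> bool list list list" where
  "extensions M = map (\<lambda>r. r # M)
    (filter (\<lambda>r. stable_mask r M \<and> \<not> has_stable 3 (map Not r) M) (masks (length M)))"

text \<open>
  \<open>js\<close> are the vertices placed so far. The rows of the goal are consumed from the last one upwards,
  since a triangular row only mentions vertices further down.
\<close>

primrec embeds :: "bool list list \<Rightarrow> nat list \<Rightarrow> bool list list \<Rightarrow> bool" where
  "embeds C js [] \<longleftrightarrow> True"
| "embeds C js (r # rs) \<longleftrightarrow>
    list_ex (\<lambda>i. i \<notin> set js \<and> map (\<lambda>j. C ! i ! j) js = r \<and> embeds C (i # js) rs) [0..<length C]"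

definition degrees :: "bool list list \<Rightarrow> nat list" where
  "degrees M = sort (map (\<lambda>r. length (filter id r)) (closed_matrix M))"

text \<open>Comparing \<open>degrees\<close> only prunes the search.\<close>

definition rearranges :: "bool list list \<Rightarrow> bool list list \<Rightarrow> bool" where
  "rearranges M N \<longleftrightarrow> length M = length N \<and> degrees M = degrees N \<and>
    embeds (closed_matrix M) [] (rev N)"

definition insert_new :: "bool list list \<Rightarrow> bool list list list \<Rightarrow> bool list list list" where
  "insert_new M L = (if list_ex (rearranges M) L then L else M # L)"

definition step :: "bool list list list \<Rightarrow> bool list list list" where
  "step L = fold insert_new (concat (map extensions L)) []"

section \<open>Completeness of the generation\<close>

lemma set_masks: "set (masks n) = {s. length s = n}"
  by (auto simp: set_n_lists)

lemma stable_mask_rows: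
  "(\<And>u v. u \<in> set xs \<Longrightarrow> v \<in> set xs \<Longrightarrow> P u \<Longrightarrow> P v \<Longrightarrow> \<not> A u v) \<Longrightarrow> stable_mask (map P xs) (rows A xs)"
  by (induction xs) (auto simp: list_all2_conv_all_nth)

text \<open>When the head is chosen, the restricted mask keeps only its non-neighbours, so putting
  it back preserves independence. With this direction a rejection by the filter always exhibits a
  forbidden set.\<close>

lemma has_stable_rowsD:
  assumes "symp A" "irreflp A" "distinct xs" "has_stable k (map P xs) (rows A xs)"
  shows "\<exists>I \<subseteq> {x \<in> set xs. P x}. card I = k \<and> (\<forall>u\<in>I. \<forall>v\<in>I. \<not> A u v)"
  using assms(3,4)
proof (induction k "map P xs" "rows A xs" arbitrary: P xs rule: has_stable.induct)
  case (1 P xs)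
  then show ?case by (intro exI[of _ "{}"]) auto
next
  case (2 k b bs r M P xs)
  then obtain x ys where xs: "xs = x # ys" by (cases xs) auto
  have eqs: "b = P x" "bs = map P ys" "r = map (A x) ys" "M = rows A ys"
    using 2(3,4) xs by auto
  have bs': "map2 (\<lambda>c e. c \<and> \<not> e) bs r = map (\<lambda>y. P y \<and> \<not> A x y) ys"
    by (simp add: eqs map2_map_map)
  consider "P x" "has_stable k (map (\<lambda>y. P y \<and> \<not> A x y) ys) (rows A ys)"
    | "has_stable (Suc k) (map P ys) (rows A ys)"
    using 2(6) by (auto simp: xs map2_map_map)
  then show ?case
  proof cases
    case 1
    then obtain I where I: "I \<subseteq> {y \<in> set ys. P y \<and> \<not> A x y}" "card I = k"
        "\<forall>u\<in>I. \<forall>v\<in>I. \<not> A u v"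
      using 2(1)[OF bs' eqs(4)] 2(5) by (auto simp: xs)
    have "x \<notin> I" "finite I"
      using I(1) 2(5) finite_subset[OF I(1)] by (auto simp: xs)
    then have "card (insert x I) = Suc k"
      using I(2) by simp
    then show ?thesis
      using I 1(1) sympD[OF assms(1)] irreflpD[OF assms(2)]
      by (intro exI[of _ "insert x I"]) (auto simp: xs)
  next
    case 2
    then show ?thesis
      using "2.hyps"(2)[OF eqs(2,4)] "2.prems" by (fastforce simp: xs)
  qed
qed auto

text \<open>Each consumed \<open>r\<close> is exactly the row that the new head \<open>i\<close>
  contributes to \<open>rows\<close>, so the matrix grows from its bottom and \<open>rev\<close>
  restores the order.\<close>

lemma embedsD:
  assumes "embeds C js rs" "distinct js" "set js \<subseteq> {..<length C}"
  shows "\<exists>is. distinct is \<and> set is \<subseteq> {..<length C} \<and> rows (\<lambda>i j. C ! i ! j) is = rev rs @ rows (\<lambda>i j. C ! i ! j) js"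
  using assms
proof (induction rs arbitrary: js)
  case (Cons r rs)
  then obtain i where "i < length C" "i \<notin> set js" "map (\<lambda>j. C ! i ! j) js = r" "embeds C (i # js) rs"
    by (auto simp: list_ex_iff)
  with Cons.IH[of "i # js"] Cons.prems show ?case
    by auto
qed auto

lemma realises_rearranges:
  assumes "symp A" "realises V A M" "rearranges M N"
  shows "realises V A N"
proof -
  obtain xs where xs: "distinct xs" "set xs = V" "rows A xs = M"
    using assms(2) by (auto simp: realises_def)
  let ?C = "closed_matrix M"
  have C: "?C = map (\<lambda>x. map (\<lambda>y. y = x \<or> A x y) xs) xs"
    using closed_matrix_rows[OF assms(1) xs(1)] xs(3) by simp
  obtain js where js: "distinct js" "set js \<subseteq> {..<length xs}" "rows (\<lambda>i j. ?C ! i ! j) js = N"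
    using embedsD[of ?C "[]" "rev N"] assms(3) by (auto simp: rearranges_def C)
  \<comment> \<open>Equal length makes the injective choice \<open>js\<close> a permutation of all
    indices, so no vertex is lost.\<close>
  have "length js = length xs"
    using assms(3) xs(3) js(3) by (metis length_rows rearranges_def)
  then have set_js: "set js = {..<length xs}"
    using js by (metis card_lessThan card_subset_eq distinct_card finite_lessThan)
  have "rows A (map ((!) xs) js) = N"
  proof -
    have "rows (\<lambda>i j. A (xs ! i) (xs ! j)) js = rows (\<lambda>i j. ?C ! i ! j) js" if "distinct js" "set js \<subseteq> {..<length xs}" for js
      using that
    proof (induction js)
      case (Cons i js)
      \<comment> \<open>Distinct indices stay off the diagonal, where \<open>?C\<close> holds
        \<open>True\<close>.\<close>
      have "A (xs ! i) (xs ! j) = ?C ! i ! j" if "j \<in> set js" for j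
        using Cons.prems that xs(1) by (auto simp: C nth_eq_iff_index_eq)
      with Cons show ?case by auto
    qed simp
    then show ?thesis using js by (simp add: rows_map)
  qed
  moreover have "distinct (map ((!) xs) js)"
    using js xs(1) by (auto simp: distinct_map inj_on_def nth_eq_iff_index_eq subset_iff)
  moreover have "set (map ((!) xs) js) = V"
    using bij_betw_imp_surj_on[OF bij_betw_nth[OF xs(1) refl refl]] set_js xs(2) by simp
  ultimately show ?thesis
    unfolding realises_def by blast
qed

lemma fold_insert_new_mono: "set L \<subseteq> set (fold insert_new Ms L)"
proof (induction Ms arbitrary: L)
  case (Cons M Ms)
  have "set L \<subseteq> set (insert_new M L)"
    by (auto simp: insert_new_def)
  with Cons[of "insert_new M L"] show ?case by simp
qed simp

text \<open>At its turn \<open>M\<close> is either inserted or matched by a matrix already kept, and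
  the fold never drops anything.\<close>

lemma fold_insert_new_complete:
  "M \<in> set Ms \<Longrightarrow> \<exists>N \<in> set (fold insert_new Ms L). N = M \<or> rearranges M N"
proof (induction Ms arbitrary: L)
  case (Cons M' Ms)
  show ?case
  proof (cases "M = M'")
    case True
    have "\<exists>N \<in> set (insert_new M L). N = M \<or> rearranges M N"
      by (auto simp: insert_new_def list_ex_iff)
    then show ?thesis
      using fold_insert_new_mono[of "insert_new M L" Ms] True by auto
  next
    case False
    then show ?thesis using Cons by auto
  qed
qed simp

text \<open>The ordering of \<open>V\<close> behind \<open>M\<close> is kept and \<open>x\<close> is
  put in front, so the enlarged matrix is literally an extension of \<open>M\<close>; its
  replacement by a rearranged copy is absorbed by the choice of ordering in
  \<open>realises\<close>.\<close>

lemma realises_step: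
  assumes "symp A" "irreflp A" "x \<notin> V" "realises V A M" "M \<in> set L"
    and nbh: "\<And>u v. u \<in> V \<Longrightarrow> v \<in> V \<Longrightarrow> A x u \<Longrightarrow> A x v \<Longrightarrow> \<not> A u v"
    and indep: "\<And>I. I \<subseteq> insert x V \<Longrightarrow> \<forall>u\<in>I. \<forall>v\<in>I. \<not> A u v \<Longrightarrow> card I \<le> 3"
  shows "\<exists>N \<in> set (step L). realises (insert x V) A N"
proof -
  obtain xs where xs: "distinct xs" "set xs = V" "rows A xs = M"
    using assms(4) by (auto simp: realises_def)
  let ?r = "map (A x) xs"
  have "stable_mask ?r M"
    using stable_mask_rows[of xs "A x" A] nbh xs by auto
  moreover have "\<not> has_stable 3 (map Not ?r) M"
  proof
    assume "has_stable 3 (map Not ?r) M"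
    then have "has_stable 3 (map (\<lambda>y. \<not> A x y) xs) (rows A xs)"
      by (simp add: xs comp_def)
    from has_stable_rowsD[OF assms(1,2) xs(1) this]
    obtain I where I: "I \<subseteq> {y \<in> V. \<not> A x y}" "card I = 3" "\<forall>u\<in>I. \<forall>v\<in>I. \<not> A u v"
      using xs(2) by auto
    have "\<forall>u\<in>insert x I. \<forall>v\<in>insert x I. \<not> A u v"
      using I sympD[OF assms(1)] irreflpD[OF assms(2)] by auto
    moreover have "insert x I \<subseteq> insert x V"
      using I(1) by auto
    ultimately have "card (insert x I) \<le> 3"
      using indep by blast
    moreover have "x \<notin> I" "finite I"
      using I assms(3) by (auto intro: card_ge_0_finite)
    ultimately show False using I(2) by simp
  qed
  ultimately have "?r # M \<in> set (extensions M)"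
    using xs(3) by (auto simp: extensions_def set_masks)
  then have "?r # M \<in> set (concat (map extensions L))"
    using assms(5) by auto
  then obtain N where N: "N \<in> set (step L)" "N = ?r # M \<or> rearranges (?r # M) N"
    unfolding step_def using fold_insert_new_complete by blast
  have "realises (insert x V) A (?r # M)"
    unfolding realises_def using xs assms(3) by (intro exI[of _ "x # xs"]) auto
  with N realises_rearranges[OF assms(1)] show ?thesis by blast
qed

text \<open>The conditions on triangles and independent sets survive the deletion of a vertex. The
  start \<open>[[]]\<close> contains just the matrix of the empty graph.\<close>

lemma realises_funpow_step:
  assumes "symp A" "irreflp A" "finite V"
    and "\<And>u v w. u \<in> V \<Longrightarrow> v \<in> V \<Longrightarrow> w \<in> V \<Longrightarrow> A u v \<Longrightarrow> A u w \<Longrightarrow> \<not> A v w"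
    and "\<And>I. I \<subseteq> V \<Longrightarrow> \<forall>u\<in>I. \<forall>v\<in>I. \<not> A u v \<Longrightarrow> card I \<le> 3"
  shows "\<exists>M \<in> set ((step ^^ card V) [[]]). realises V A M"
  using assms(3-5)
proof (induction V rule: finite_induct)
  case empty
  then show ?case by (simp add: realises_def)
next
  case (insert x V)
  have "\<exists>M \<in> set ((step ^^ card V) [[]]). realises V A M"
    using insert.prems by (intro insert.IH) blast+
  then obtain M where M: "M \<in> set ((step ^^ card V) [[]])" "realises V A M" by blast
  have "\<exists>N \<in> set (step ((step ^^ card V) [[]])). realises (insert x V) A N"
    using insert.prems by (intro realises_step[OF assms(1,2) insert.hyps(2) M(2,1)]) blast+
  with insert.hyps show ?case by simp
qed

section \<open>Executable domination and connectedness\<close>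

definition meets :: "bool list \<Rightarrow> bool list \<Rightarrow> bool" where
  "meets s r \<longleftrightarrow> list_ex (\<lambda>(a, b). a \<and> b) (zip s r)"

definition mask_dominates :: "bool list list \<Rightarrow> bool list \<Rightarrow> bool" where
  "mask_dominates C s \<longleftrightarrow> list_all (meets s) C"

fun removals :: "bool list \<Rightarrow> bool list list" where
  "removals [] = []"
| "removals (b # bs) = (if b then [False # bs] else []) @ map ((#) b) (removals bs)"

definition mask_min_dominates :: "bool list list \<Rightarrow> bool list \<Rightarrow> bool" where
  "mask_min_dominates C s \<longleftrightarrow> mask_dominates C s \<and> list_all (\<lambda>t. \<not> mask_dominates C t) (removals s)"

definition min_dominating_sizes :: "bool list list \<Rightarrow> nat list" where
  "min_dominating_sizes M = map (\<lambda>s. length (filter id s))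
    (filter (mask_min_dominates (closed_matrix M)) (masks (length M)))"

definition well_dominated_matrix :: "bool list list \<Rightarrow> bool" where
  "well_dominated_matrix M \<longleftrightarrow>
    (\<forall>k \<in> set (min_dominating_sizes M). \<forall>l \<in> set (min_dominating_sizes M). k = l)"

text \<open>A mask equal to its own closed neighbourhood is a union of components. The library
  notion demands a vertex, and \<open>M \<noteq> []\<close> mirrors this: the empty matrix is
  well-dominated but matches no target.\<close>

definition connected_matrix :: "bool list list \<Rightarrow> bool" where
  "connected_matrix M \<longleftrightarrow> M \<noteq> [] \<and> list_all
    (\<lambda>s. map (meets s) (closed_matrix M) = s \<longrightarrow> list_all id s \<or> \<not> list_ex id s)
    (masks (length M))"

lemma meets_map: "meets (map P xs) (map Q xs) \<longleftrightarrow> (\<exists>x\<in>set xs. P x \<and> Q x)"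
  by (induction xs) (auto simp: meets_def)

lemma map_surj_distinct:
  assumes "distinct xs" "length s = length xs"
  shows "\<exists>D \<subseteq> set xs. s = map (\<lambda>x. x \<in> D) xs"
proof -
  let ?D = "{xs ! i |i. i < length xs \<and> s ! i}"
  have "s = map (\<lambda>x. x \<in> ?D) xs"
    using assms by (intro nth_equalityI) (auto simp: nth_eq_iff_index_eq)
  then show ?thesis by (intro exI[of _ ?D]) auto
qed

lemma removals_map:
  "distinct xs \<Longrightarrow>
    set (removals (map P xs)) = (\<lambda>x. map (\<lambda>y. P y \<and> y \<noteq> x) xs) ` {x \<in> set xs. P x}"
proof (induction xs)
  case (Cons z xs)
  have 1: "map P xs = map (\<lambda>y. P y \<and> y \<noteq> z) xs"
    using Cons.prems by auto
  have 2: "map (\<lambda>y. P y \<and> y \<noteq> x) (z # xs) = P z # map (\<lambda>y. P y \<and> y \<noteq> x) xs" if "x \<in> set xs" for x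
    using that Cons.prems by auto
  have "set (removals (map P (z # xs))) = (if P z then {False # map P xs} else {}) \<union>
      (\<lambda>x. map (\<lambda>y. P y \<and> y \<noteq> x) (z # xs)) ` {x \<in> set xs. P x}"
    using Cons 2 by (simp add: image_image)
  also have "\<dots> = (\<lambda>x. map (\<lambda>y. P y \<and> y \<noteq> x) (z # xs)) ` {x \<in> set (z # xs). P x}"
    using 1 by auto
  finally show ?case .
qed simp

section \<open>Graph-theoretic meaning of the matrix tests\<close>

context pair_graph
begin

lemma symp_adj: "symp (adj G)"
  using arcs_symmetric by (auto intro: sympI)

lemma irreflp_adj: "irreflp (adj G)"
  using no_loops' by (auto intro: irreflpI)

text \<open>Domination passes to supersets, so a proper dominating subset can be enlarged until it
  omits just one vertex. This is why \<open>removals\<close> tries single deletions only.\<close>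

lemma minimal_dominating_set_iff:
  "minimal_dominating_set G D \<longleftrightarrow> dominating_set G D \<and> (\<forall>x\<in>D. \<not> dominating_set G (D - {x}))"
proof -
  have "dominating_set G (D - {x})" if "dominating_set G D" "D' \<subset> D" "dominating_set G D'" "x \<in> D - D'" for x D'
    using that unfolding dominating_set_def by blast
  then show ?thesis
    unfolding minimal_dominating_set_def by blast
qed

text \<open>A dominating set of least size has no smaller one inside it; the minimum exists because
  \<open>pverts G\<close> dominates.\<close>

lemma exists_minimal_dominating_set:
  obtains D where "minimal_dominating_set G D" "card D = domination_number G"
proof -
  let ?\<D> = "{D. dominating_set G D}"
  have "?\<D> \<subseteq> Pow (pverts G)" "pverts G \<in> ?\<D>"
    by (auto simp: dominating_set_def)
  then have fin: "finite (card ` ?\<D>)" "card ` ?\<D> \<noteq> {}"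
    using pair_finite_verts finite_subset by blast+
  obtain D where D: "dominating_set G D" "card D = domination_number G"
    using Min_in[OF fin] unfolding domination_number_def by auto
  have "\<not> dominating_set G D'" if "D' \<subset> D" for D'
  proof
    assume "dominating_set G D'"
    then have "card D \<le> card D'"
      unfolding D(2) domination_number_def using fin by (intro Min_le) auto
    moreover have "finite D"
      using D(1) finite_subset[OF _ pair_finite_verts] by (auto simp: dominating_set_def)
    ultimately show False using psubset_card_mono[OF _ that] by simp
  qed
  with D that show thesis unfolding minimal_dominating_set_def by blast
qed

text \<open>A maximal independent set is a minimal dominating set.\<close>

lemma card_independent_le:
  assumes "well_dominated G" "I \<subseteq> pverts G" "\<forall>u\<in>I. \<forall>v\<in>I. \<not> adj G u v"
  shows "card I \<le> domination_number G"
proof -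
  let ?\<I> = "{J. J \<subseteq> pverts G \<and> (\<forall>u\<in>J. \<forall>v\<in>J. \<not> adj G u v)}"
  have "?\<I> \<subseteq> Pow (pverts G)" by blast
  then have "finite ?\<I>"
    by (rule finite_subset) (simp add: pair_finite_verts)
  from finite_has_maximal2[OF this, of I] assms
  obtain J where J: "J \<in> ?\<I>" "I \<subseteq> J" and max: "\<And>K. K \<in> ?\<I> \<Longrightarrow> J \<subseteq> K \<Longrightarrow> J = K"
    by auto
  have "\<exists>u\<in>J. adj G u v" if "v \<in> pverts G" "v \<notin> J" for v
  proof (rule ccontr)
    assume "\<not> ?thesis"
    then have "insert v J \<in> ?\<I>"
      using J that arcs_symmetric no_loops'[of v v] by auto
    then show False using max that by blast
  qed
  \<comment> \<open>By independence, a vertex removed from \<open>J\<close> is not dominated by the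
    rest.\<close>
  then have "minimal_dominating_set G J"
    using J(1) unfolding minimal_dominating_set_iff dominating_set_def by blast
  moreover obtain D where "minimal_dominating_set G D" "card D = domination_number G"
    by (rule exists_minimal_dominating_set)
  ultimately have "card J = domination_number G"
    using assms(1) unfolding well_dominated_def by metis
  moreover have "finite J"
    using J finite_subset[OF _ pair_finite_verts] by auto
  ultimately show ?thesis using card_mono[OF _ J(2)] by simp
qed

text \<open>Since arcs are symmetric, connectedness supplies directed walks between any two
  vertices, and membership in \<open>D\<close> propagates along them.\<close>

lemma connected_closed_set:
  assumes "connected (with_proj G)" "D \<subseteq> pverts G" "u \<in> D" "v \<in> pverts G"
    and closed: "\<And>x y. x \<in> D \<Longrightarrow> adj G x y \<Longrightarrow> y \<in> D"
  shows "v \<in> D"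
proof -
  have "strongly_connected (with_proj G)"
    using symmetric_connected_imp_strongly_connected[OF pair_sym_arcs assms(1)] .
  then have "(u, v) \<in> rtrancl_on (pverts G) (parcs G)"
    using assms(2-4) unfolding strongly_connected_def reachable_def by auto
  then show ?thesis
    by (induction rule: rtrancl_on_induct) (use assms in auto)
qed

context
  fixes xs assumes xs: "distinct xs" "set xs = pverts G"
begin

lemma mask_dominates_iff:
  assumes "D \<subseteq> pverts G"
  shows "mask_dominates (closed_matrix (rows (adj G) xs)) (map (\<lambda>x. x \<in> D) xs) \<longleftrightarrow> dominating_set G D"
proof -
  have "mask_dominates (closed_matrix (rows (adj G) xs)) (map (\<lambda>x. x \<in> D) xs) \<longleftrightarrow>
      (\<forall>v\<in>pverts G. \<exists>u\<in>pverts G. u \<in> D \<and> (u = v \<or> adj G v u))"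
    using xs by (simp add: mask_dominates_def closed_matrix_rows symp_adj list_all_iff meets_map)
  also have "\<dots> \<longleftrightarrow> dominating_set G D"
    using assms arcs_symmetric unfolding dominating_set_def by blast
  finally show ?thesis .
qed

lemma mask_min_dominates_iff:
  assumes "D \<subseteq> pverts G"
  shows "mask_min_dominates (closed_matrix (rows (adj G) xs)) (map (\<lambda>x. x \<in> D) xs) \<longleftrightarrow>
    minimal_dominating_set G D"
proof -
  have "mask_dominates (closed_matrix (rows (adj G) xs)) (map (\<lambda>y. y \<in> D \<and> y \<noteq> x) xs) \<longleftrightarrow>
      dominating_set G (D - {x})" for x
    using mask_dominates_iff[of "D - {x}"] assms by auto
  then show ?thesis
    using assms xs
    by (auto simp: mask_min_dominates_def minimal_dominating_set_iff mask_dominates_iff list_all_iff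
        removals_map image_iff)
qed

lemma set_min_dominating_sizes:
  "set (min_dominating_sizes (rows (adj G) xs)) = card ` {D. minimal_dominating_set G D}"
proof -
  let ?C = "closed_matrix (rows (adj G) xs)" and ?m = "\<lambda>D. map (\<lambda>x. x \<in> D) xs"
  have "{s. length s = length xs \<and> mask_min_dominates ?C s} = ?m ` {D. minimal_dominating_set G D}"
  proof (intro set_eqI iffI)
    fix s assume "s \<in> {s. length s = length xs \<and> mask_min_dominates ?C s}"
    moreover then obtain D where "D \<subseteq> set xs" "s = ?m D"
      using map_surj_distinct[OF xs(1)] by blast
    ultimately show "s \<in> ?m ` {D. minimal_dominating_set G D}"
      using mask_min_dominates_iff xs(2) by auto
  next
    fix s assume "s \<in> ?m ` {D. minimal_dominating_set G D}"
    then show "s \<in> {s. length s = length xs \<and> mask_min_dominates ?C s}"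
      using mask_min_dominates_iff by (auto simp: minimal_dominating_set_def dominating_set_def)
  qed
  moreover have "length (filter id (?m D)) = card D" if "minimal_dominating_set G D" for D
  proof -
    have "D \<subseteq> set xs"
      using that xs(2) by (auto simp: minimal_dominating_set_def dominating_set_def)
    then have "D \<inter> set xs = D" by blast
    then show ?thesis
      using distinct_length_filter[OF xs(1), of "\<lambda>x. x \<in> D"] by (simp add: filter_map comp_def)
  qed
  ultimately show ?thesis
    by (auto simp: min_dominating_sizes_def set_masks image_iff)
qed

lemma connected_matrix_rows:
  assumes "connected (with_proj G)"
  shows "connected_matrix (rows (adj G) xs)"
proof -
  have "pverts G \<noteq> {}"
    using symmetric_connected_imp_strongly_connected[OF pair_sym_arcs assms]
    by (simp add: strongly_connected_def)
  then have "rows (adj G) xs \<noteq> []"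
    using xs(2) by (metis length_0_conv length_rows set_empty)
  moreover have "list_all id s \<or> \<not> list_ex id s"
    if "length s = length xs" "map (meets s) (closed_matrix (rows (adj G) xs)) = s" for s
  proof -
    obtain D where D: "D \<subseteq> pverts G" "s = map (\<lambda>x. x \<in> D) xs"
      using map_surj_distinct[OF xs(1)] \<open>length s = length xs\<close> xs(2) by metis
    \<comment> \<open>The fixed-point equation read vertex by vertex: \<open>D\<close> is its own
      closed neighbourhood.\<close>
    have nbh: "(\<exists>u\<in>pverts G. u \<in> D \<and> (u = v \<or> adj G v u)) \<longleftrightarrow> v \<in> D" if "v \<in> pverts G" for v
      using \<open>map _ _ = s\<close> that xs
      by (simp add: D(2) closed_matrix_rows symp_adj meets_map comp_def)
    have "y \<in> D" if "x \<in> D" "adj G x y" for x y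
      using that nbh[of y] in_arcsD1 in_arcsD2 arcs_symmetric by blast
    then have "\<forall>u\<in>D. \<forall>v\<in>pverts G. v \<in> D"
      using connected_closed_set[OF assms D(1)] by blast
    then show ?thesis
      using D xs(2) by (auto simp: list_all_iff list_ex_iff)
  qed
  ultimately show ?thesis
    by (auto simp: connected_matrix_def list_all_iff set_masks)
qed

end

lemma well_dominated_realises:
  assumes "realises (pverts G) (adj G) M"
  shows "well_dominated G \<longleftrightarrow> well_dominated_matrix M"
proof -
  obtain xs where "distinct xs" "set xs = pverts G" "rows (adj G) xs = M"
    using assms by (auto simp: realises_def)
  then have "set (min_dominating_sizes M) = card ` {D. minimal_dominating_set G D}"
    using set_min_dominating_sizes by blast
  then show ?thesis
    unfolding well_dominated_matrix_def well_dominated_def by auto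
qed

lemma connected_realises:
  assumes "realises (pverts G) (adj G) M" "connected (with_proj G)"
  shows "connected_matrix M"
  using assms connected_matrix_rows by (auto simp: realises_def)

end

section \<open>Isomorphism\<close>

text \<open>Arcs are pairs whose ends are their projections, which forces the arc component of a
  library isomorphism to be the vertex map on both coordinates.\<close>

lemma isomorphicD:
  assumes "G \<simeq> H"
  shows "\<exists>f. bij_betw f (pverts G) (pverts H) \<and>
    (\<forall>u\<in>pverts G. \<forall>v\<in>pverts G. adj G u v \<longleftrightarrow> adj H (f u) (f v))"
proof -
  obtain h where h: "pre_digraph.digraph_isomorphism (with_proj G) h" and H: "with_proj H = app_iso h (with_proj G)"
    using assms by (auto simp: isomorphic_def digraph_iso_def)
  let ?f = "iso_verts h"
  have wf: "wf_digraph (with_proj G)" and inj: "inj_on ?f (pverts G)"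
    and ends: "\<And>a. a \<in> parcs G \<Longrightarrow> ?f (fst a) = iso_tail h (iso_arcs h a) \<and> ?f (snd a) = iso_head h (iso_arcs h a)"
    using h by (auto simp: pre_digraph.digraph_isomorphism_def)
  have pH: "pverts H = ?f ` pverts G" "parcs H = iso_arcs h ` parcs G" "fst = iso_tail h" "snd = iso_head h"
    using H by (auto simp: with_proj_def app_iso_def)
  have arc: "iso_arcs h a = (?f (fst a), ?f (snd a))" if "a \<in> parcs G" for a
    using ends[OF that] pH(3,4) by (metis prod.collapse)
  interpret pair_wf_digraph G
    using wf by (simp add: wf_digraph_wp_iff)
  have "adj G u v \<longleftrightarrow> adj H (?f u) (?f v)" if "u \<in> pverts G" "v \<in> pverts G" for u v
  proof
    assume "adj G u v"
    then show "adj H (?f u) (?f v)"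
      using arc[of "(u, v)"] by (auto simp: pH(2) image_iff intro: bexI[of _ "(u, v)"])
  next
    assume "adj H (?f u) (?f v)"
    then obtain a where a: "a \<in> parcs G" "(?f u, ?f v) = iso_arcs h a"
      by (auto simp: pH(2))
    then have "u = fst a" "v = snd a"
      using arc[OF a(1)] inj that arc_fst_in_verts arc_snd_in_verts
      by (auto dest: inj_onD)
    then show "adj G u v" using a(1) by simp
  qed
  then show ?thesis
    using inj pH(1) by (auto simp: bij_betw_def)
qed

lemma isomorphicI:
  assumes "pair_wf_digraph G" "pair_wf_digraph H" "bij_betw f (pverts G) (pverts H)"
    and adj: "\<And>u v. u \<in> pverts G \<Longrightarrow> v \<in> pverts G \<Longrightarrow> adj G u v \<longleftrightarrow> adj H (f u) (f v)"
  shows "G \<simeq> H"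
proof -
  interpret G: pair_wf_digraph G by fact
  interpret H: pair_wf_digraph H by fact
  have inj: "inj_on f (pverts G)" and im: "f ` pverts G = pverts H"
    using assms(3) by (auto simp: bij_betw_def)
  let ?h = "\<lparr>iso_verts = f, iso_arcs = map_prod f f, iso_head = snd, iso_tail = fst\<rparr>"
  have "parcs G \<subseteq> pverts G \<times> pverts G"
    using G.in_arcsD1 G.in_arcsD2 by auto
  then have "inj_on (map_prod f f) (parcs G)"
    by (rule inj_on_subset[OF map_prod_inj_on[OF inj inj]])
  then have "G.digraph_isomorphism ?h"
    using G.wf_digraph_axioms inj by (simp add: G.digraph_isomorphism_def)
  moreover have "map_prod f f ` parcs G = parcs H"
  proof (intro set_eqI iffI)
    fix a assume "a \<in> map_prod f f ` parcs G"
    then obtain u v where "adj G u v" "a = (f u, f v)" by auto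
    then show "a \<in> parcs H" using adj[of u v] G.in_arcsD1[of u v] G.in_arcsD2[of u v] by simp
  next
    fix a assume a: "a \<in> parcs H"
    then obtain u v where "u \<in> pverts G" "v \<in> pverts G" "a = (f u, f v)"
      using H.arc_fst_in_verts H.arc_snd_in_verts im by (metis (no_types, lifting) imageE prod.collapse)
    then show "a \<in> map_prod f f ` parcs G" using adj[of u v] a by (auto intro: rev_image_eqI[of "(u, v)"])
  qed
  ultimately show ?thesis
    using im unfolding isomorphic_def digraph_iso_def
    by (intro exI[of _ ?h]) (simp add: app_iso_def with_proj_def)
qed

text \<open>An isomorphism transports the ordering of \<open>H\<close> to \<open>G\<close>.
  Conversely, vertices in equal positions are matched: the triangle settles increasing pairs,
  symmetry the decreasing ones, looplessness the diagonal.\<close>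

lemma isomorphic_iff_realises:
  assumes "pair_graph G" "pair_graph H" "realises (pverts H) (adj H) M"
  shows "G \<simeq> H \<longleftrightarrow> realises (pverts G) (adj G) M"
proof
  interpret G: pair_graph G by fact
  interpret H: pair_graph H by fact
  obtain ys where ys: "distinct ys" "set ys = pverts H" "rows (adj H) ys = M"
    using assms(3) by (auto simp: realises_def)
  {
    assume "G \<simeq> H"
    then obtain f where f: "bij_betw f (pverts G) (pverts H)"
        "\<And>u v. u \<in> pverts G \<Longrightarrow> v \<in> pverts G \<Longrightarrow> adj G u v \<longleftrightarrow> adj H (f u) (f v)"
      using isomorphicD by blast
    let ?g = "inv_into (pverts G) f"
    have g: "bij_betw ?g (pverts H) (pverts G)"
      using f(1) by (rule bij_betw_inv_into)
    have "rows (\<lambda>u v. adj G (?g u) (?g v)) ys = rows (adj H) ys"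
      using g ys(2) f bij_betw_inv_into_right[OF f(1)] by (intro rows_cong) (auto dest: bij_betwE)
    then show "realises (pverts G) (adj G) M"
      unfolding realises_def using g ys
      by (intro exI[of _ "map ?g ys"]) (auto simp: rows_map distinct_map bij_betw_def)
  }
  assume "realises (pverts G) (adj G) M"
  then obtain xs where xs: "distinct xs" "set xs = pverts G" "rows (adj G) xs = M"
    by (auto simp: realises_def)
  have len: "length xs = length ys"
    using xs(3) ys(3) by (metis length_rows)
  have bx: "bij_betw ((!) xs) {..<length xs} (pverts G)"
    using bij_betw_nth[OF xs(1)] xs(2) by simp
  have by': "bij_betw ((!) ys) {..<length xs} (pverts H)"
    using bij_betw_nth[OF ys(1)] ys(2) len by simp
  let ?i = "inv_into {..<length xs} ((!) xs)"
  have bij: "bij_betw ((!) ys \<circ> ?i) (pverts G) (pverts H)"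
    using bij_betw_trans[OF bij_betw_inv_into[OF bx] by'] .
  have lt: "adj G (xs ! i) (xs ! j) = adj H (ys ! i) (ys ! j)" if "i < j" "j < length xs" for i j
    using rows_eqD[of "adj G" xs "adj H" ys j i] that xs(3) ys(3) by simp
  have eq: "adj G (xs ! i) (xs ! j) = adj H (ys ! i) (ys ! j)" if "i < length xs" "j < length xs" for i j
  proof (cases i j rule: linorder_cases)
    case equal
    then show ?thesis
      using G.no_loops' H.no_loops' by blast
  next
    case greater
    then show ?thesis
      using lt[of j i] that G.arcs_symmetric H.arcs_symmetric by blast
  qed (use lt that in blast)
  show "G \<simeq> H"
  proof (rule isomorphicI[OF _ _ bij])
    fix u v assume "u \<in> pverts G" "v \<in> pverts G"
    then obtain i j where "i < length xs" "j < length xs" "u = xs ! i" "v = xs ! j"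
      using xs(2) by (metis in_set_conv_nth)
    then show "adj G u v \<longleftrightarrow> adj H (((!) ys \<circ> ?i) u) (((!) ys \<circ> ?i) v)"
      using eq bij_betw_inv_into_left[OF bx] by simp
  qed (rule G.pair_wf_digraph H.pair_wf_digraph)+
qed

section \<open>The eleven graphs\<close>

text \<open>\<open>rows\<close> queries a pair only in list order, so each edge must be written with
  its smaller end first.\<close>

definition edge_matrix :: "nat list \<Rightarrow> (nat \<times> nat) list \<Rightarrow> bool list list" where
  "edge_matrix xs es = rows (\<lambda>i j. (i, j) \<in> set es) xs"

definition targets :: "bool list list list" where
  "targets = [
    edge_matrix [0..<1] [],
    edge_matrix [0..<2] [(0,1)],
    edge_matrix [0..<4] [(0,1),(1,2),(2,3)],
    edge_matrix [0..<4] [(0,1),(1,2),(2,3),(0,3)],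
    edge_matrix [0..<5] [(0,1),(1,2),(2,3),(3,4),(0,4)],
    edge_matrix [0..<7] [(0,1),(1,2),(2,3),(3,4),(4,5),(5,6),(0,6)],
    edge_matrix [0..<6] [(0,1),(1,2),(0,3),(1,4),(2,5)],
    edge_matrix [1..<8] [(1,2),(1,3),(2,5),(3,6),(5,6),(4,7),(6,7)],
    edge_matrix [1..<8] [(1,2),(1,3),(2,5),(3,6),(5,6),(4,7),(6,7),(1,7)],
    edge_matrix [1..<8] [(1,2),(1,3),(2,5),(3,6),(5,6),(4,7),(6,7),(3,4)],
    edge_matrix [1..<8] [(1,2),(1,3),(2,5),(3,6),(5,6),(4,7),(6,7),(3,4),(1,7)]]"

text \<open>The final \<open>L = []\<close> says that the generation has died out.\<close>

fun check :: "nat \<Rightarrow> bool list list list \<Rightarrow> bool" where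
  "check 0 L \<longleftrightarrow> L = []"
| "check (Suc k) L \<longleftrightarrow>
    list_all (\<lambda>M. connected_matrix M \<longrightarrow> well_dominated_matrix M \<longrightarrow> list_ex (rearranges M) targets) L \<and>
    check k (step L)"

text \<open>Well-domination can be read off any realised matrix, so this evaluation settles the
  direction from the eleven graphs to well-domination.\<close>

lemma well_dominated_targets: "list_all well_dominated_matrix targets"
  by code_simp

text \<open>Levels 0 to 8 are compared with the targets, and the emptiness of level 9 is the
  computational form of \<open>R(3,4) \<le> 9\<close>. No target has 8 vertices, so level 8 passes
  only because no connected graph in it is well-dominated.\<close>

lemma check_9: "check 9 [[]]"
  by code_simp

lemma checkD:
  "check k L \<Longrightarrow> (\<forall>j<k. \<forall>M \<in> set ((step ^^ j) L). connected_matrix M \<longrightarrow> well_dominated_matrix M \<longrightarrow>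
    (\<exists>T \<in> set targets. rearranges M T)) \<and> (step ^^ k) L = []"
proof (induction k arbitrary: L)
  case (Suc k)
  have "(\<forall>j<k. \<forall>M \<in> set ((step ^^ Suc j) L). connected_matrix M \<longrightarrow> well_dominated_matrix M \<longrightarrow>
    (\<exists>T \<in> set targets. rearranges M T)) \<and> (step ^^ Suc k) L = []"
    using Suc.IH[of "step L"] Suc.prems by (simp add: funpow_swap1)
  then show ?case
    using Suc.prems by (auto simp: less_Suc_eq_0_disj list_all_iff list_ex_iff simp del: funpow.simps(2))
qed simp

lemma step_Nil: "(step ^^ k) [] = []"
  by (induction k) (simp_all add: step_def)

lemma (in pair_graph) well_dominated_imp_target:
  assumes "connected (with_proj G)" "triangle_free G" "domination_number G \<le> 3" "well_dominated G"
  shows "\<exists>T \<in> set targets. realises (pverts G) (adj G) T"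
proof -
  have "\<not> adj G v w" if "adj G u v" "adj G u w" for u v w
    using assms(2) that arcs_symmetric unfolding triangle_free_def by blast
  moreover have "card I \<le> 3" if "I \<subseteq> pverts G" "\<forall>u\<in>I. \<forall>v\<in>I. \<not> adj G u v" for I
    using card_independent_le[OF assms(4) that] assms(3) by simp
  ultimately have "\<exists>M \<in> set ((step ^^ card (pverts G)) [[]]). realises (pverts G) (adj G) M"
    by (intro realises_funpow_step[OF symp_adj irreflp_adj pair_finite_verts])
  then obtain M where M: "M \<in> set ((step ^^ card (pverts G)) [[]])" "realises (pverts G) (adj G) M"
    by blast
  have "card (pverts G) < 9"
  proof (rule ccontr)
    assume "\<not> ?thesis"
    \<comment> \<open>Level 9 is empty and \<open>step\<close> yields nothing from an empty list, so
      all later levels are empty too.\<close>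
    then have "(step ^^ card (pverts G)) [[]] = (step ^^ (card (pverts G) - 9)) ((step ^^ 9) [[]])"
      using funpow_add[of "card (pverts G) - 9" 9 step] by simp
    then show False
      using M(1) checkD[OF check_9] by (simp add: step_Nil)
  qed
  moreover have "connected_matrix M" "well_dominated_matrix M"
    using connected_realises[OF M(2)] well_dominated_realises[OF M(2)] assms by simp_all
  ultimately obtain T where "T \<in> set targets" "rearranges M T"
    using checkD[OF check_9] M(1) by blast
  then show ?thesis
    using realises_rearranges[OF symp_adj M(2)] by blast
qed

section \<open>Matrices of the eleven named graphs\<close>

lemma adj_graph_of_edges: "adj (graph_of_edges V E) u v \<longleftrightarrow> {u, v} \<in> E"
  by (simp add: graph_of_edges_def)

lemma pverts_graph_of_edges: "pverts (graph_of_edges V E) = V"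
  by (simp add: graph_of_edges_def)

lemma pverts_graphs:
  "pverts (complete_graph n) = {..<n}" "pverts (path_graph n) = {..<n}"
  "pverts (cycle_graph n) = {..<n}" "pverts (corona_K1 F) = Inl ` pverts F \<union> Inr ` pverts F"
  by (simp_all add: complete_graph_def path_graph_def cycle_graph_def corona_K1_def
      pverts_graph_of_edges)

lemma adj_path_graph: "adj (path_graph n) u v \<longleftrightarrow> u < n \<and> v < n \<and> (v = Suc u \<or> u = Suc v)"
  by (auto simp: path_graph_def adj_graph_of_edges doubleton_eq_iff)

lemma adj_cycle_graph:
  "adj (cycle_graph n) u v \<longleftrightarrow> u < n \<and> v = Suc u mod n \<or> v < n \<and> u = Suc v mod n"
  by (auto simp: cycle_graph_def adj_graph_of_edges doubleton_eq_iff)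

lemma adj_complete_graph: "adj (complete_graph n) u v \<longleftrightarrow> u < n \<and> v < n \<and> u \<noteq> v"
  by (auto simp: complete_graph_def adj_graph_of_edges doubleton_eq_iff)

lemma adj_corona_K1:
  assumes "pair_graph F"
  shows "adj (corona_K1 F) (Inl u) (Inl v) \<longleftrightarrow> adj F u v"
    and "adj (corona_K1 F) (Inl u) (Inr v) \<longleftrightarrow> u = v \<and> v \<in> pverts F"
    and "adj (corona_K1 F) (Inr u) (Inl v) \<longleftrightarrow> u = v \<and> v \<in> pverts F"
    and "adj (corona_K1 F) (Inr u) (Inr v) \<longleftrightarrow> False"
  \<comment> \<open>Edges of the corona are unordered, so recovering the arc of \<open>F\<close> in
    a given direction uses its symmetry.\<close>
  using pair_sym_digraph.arcs_symmetric[of F u v] pair_sym_digraph.arcs_symmetric[of F v u] assms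
  by (auto simp: corona_K1_def adj_graph_of_edges doubleton_eq_iff pair_graph_def pair_pseudo_graph_def)

lemma pair_graph_complete_graph: "pair_graph (complete_graph n)"
  unfolding complete_graph_def by (rule pair_graph_graph_of_edges) auto

lemma pair_graph_path_graph: "pair_graph (path_graph n)"
  unfolding path_graph_def by (rule pair_graph_graph_of_edges) auto

text \<open>For \<open>n = 1\<close> the edge \<open>{0, Suc 0 mod 1}\<close> collapses to a
  singleton, hence the bound.\<close>

lemma pair_graph_cycle_graph:
  assumes "2 \<le> n"
  shows "pair_graph (cycle_graph n)"
proof -
  have "i \<noteq> Suc i mod n" "Suc i mod n < n" if "i < n" for i
    using that assms by (auto simp: mod_Suc)
  then show ?thesis
    unfolding cycle_graph_def by (intro pair_graph_graph_of_edges) auto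
qed

lemma pair_graph_corona_K1:
  assumes "pair_graph F"
  shows "pair_graph (corona_K1 F)"
proof -
  interpret pair_graph F by fact
  show ?thesis
    unfolding corona_K1_def
    by (rule pair_graph_graph_of_edges) (auto simp: pair_finite_verts card_insert_if dest: in_arcsD1 in_arcsD2 no_loops')
qed

lemma pair_graph_H:
  "pair_graph H1" "pair_graph H2" "pair_graph H3" "pair_graph H4"
  unfolding H1_def H2_def H3_def H4_def H1_edges_def
  by (rule pair_graph_graph_of_edges; auto)+

lemma realisesI:
  "distinct xs \<Longrightarrow> set xs = V \<Longrightarrow> rows A xs = M \<Longrightarrow> realises V A M"
  unfolding realises_def by blast

lemma realises_complete_graph:
  "realises (pverts (complete_graph 1)) (adj (complete_graph 1)) (edge_matrix [0..<1] [])"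
  "realises (pverts (complete_graph 2)) (adj (complete_graph 2)) (edge_matrix [0..<2] [(0,1)])"
proof -
  show "realises (pverts (complete_graph 1)) (adj (complete_graph 1)) (edge_matrix [0..<1] [])"
    by (rule realisesI[of "[0..<1]"]) (auto simp: edge_matrix_def pverts_graphs)
  show "realises (pverts (complete_graph 2)) (adj (complete_graph 2)) (edge_matrix [0..<2] [(0,1)])"
    by (rule realisesI[of "[0..<2]"])
      (auto simp: adj_complete_graph edge_matrix_def upt_rec pverts_graphs)
qed

lemma realises_path_graph_4:
  "realises (pverts (path_graph 4)) (adj (path_graph 4)) (edge_matrix [0..<4] [(0,1),(1,2),(2,3)])"
  by (rule realisesI[of "[0..<4]"])
    (auto simp: adj_path_graph edge_matrix_def upt_rec pverts_graphs)

lemma realises_cycle_graph: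
  "realises (pverts (cycle_graph 4)) (adj (cycle_graph 4))
    (edge_matrix [0..<4] [(0,1),(1,2),(2,3),(0,3)])"
  "realises (pverts (cycle_graph 5)) (adj (cycle_graph 5))
    (edge_matrix [0..<5] [(0,1),(1,2),(2,3),(3,4),(0,4)])"
  "realises (pverts (cycle_graph 7)) (adj (cycle_graph 7))
    (edge_matrix [0..<7] [(0,1),(1,2),(2,3),(3,4),(4,5),(5,6),(0,6)])"
proof -
  show "realises (pverts (cycle_graph 4)) (adj (cycle_graph 4))
      (edge_matrix [0..<4] [(0,1),(1,2),(2,3),(0,3)])"
    by (rule realisesI[of "[0..<4]"])
      (auto simp: adj_cycle_graph edge_matrix_def upt_rec pverts_graphs)
  show "realises (pverts (cycle_graph 5)) (adj (cycle_graph 5))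
      (edge_matrix [0..<5] [(0,1),(1,2),(2,3),(3,4),(0,4)])"
    by (rule realisesI[of "[0..<5]"])
      (auto simp: adj_cycle_graph edge_matrix_def upt_rec pverts_graphs)
  show "realises (pverts (cycle_graph 7)) (adj (cycle_graph 7))
      (edge_matrix [0..<7] [(0,1),(1,2),(2,3),(3,4),(4,5),(5,6),(0,6)])"
    by (rule realisesI[of "[0..<7]"])
      (auto simp: adj_cycle_graph edge_matrix_def upt_rec pverts_graphs)
qed

lemma realises_corona:
  "realises (pverts (corona_K1 (path_graph 3))) (adj (corona_K1 (path_graph 3)))
    (edge_matrix [0..<6] [(0,1),(1,2),(0,3),(1,4),(2,5)])"
  \<comment> \<open>The leaf of vertex \<open>i\<close> gets position \<open>i + 3\<close>, whence
    the pairs \<open>(0,3)\<close>, \<open>(1,4)\<close>, \<open>(2,5)\<close>.\<close>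
  by (rule realisesI[of "map Inl [0..<3] @ map Inr [0..<3]"])
    (auto simp: adj_corona_K1[OF pair_graph_path_graph] adj_path_graph edge_matrix_def upt_rec
      pverts_graphs distinct_map)

lemma realises_H:
  "realises (pverts H1) (adj H1)
    (edge_matrix [1..<8] [(1,2),(1,3),(2,5),(3,6),(5,6),(4,7),(6,7)])"
  "realises (pverts H2) (adj H2)
    (edge_matrix [1..<8] [(1,2),(1,3),(2,5),(3,6),(5,6),(4,7),(6,7),(1,7)])"
  "realises (pverts H3) (adj H3)
    (edge_matrix [1..<8] [(1,2),(1,3),(2,5),(3,6),(5,6),(4,7),(6,7),(3,4)])"
  "realises (pverts H4) (adj H4)
    (edge_matrix [1..<8] [(1,2),(1,3),(2,5),(3,6),(5,6),(4,7),(6,7),(3,4),(1,7)])"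
  unfolding H1_def H2_def H3_def H4_def H1_edges_def pverts_graph_of_edges
  by (rule realisesI[of "[1..<8]"];
      auto simp: adj_graph_of_edges doubleton_eq_iff edge_matrix_def upt_rec)+

theorem mainTheorem5:
  fixes G :: "'a pair_pre_digraph"
  assumes "pair_graph G"
    and "connected (with_proj G)"
    and "triangle_free G"
    and "domination_number G \<le> 3"
  shows "well_dominated G \<longleftrightarrow>
    G \<simeq> complete_graph 1 \<or> G \<simeq> complete_graph 2 \<or> G \<simeq> path_graph 4 \<or>
    G \<simeq> cycle_graph 4 \<or> G \<simeq> cycle_graph 5 \<or> G \<simeq> cycle_graph 7 \<or>
    G \<simeq> corona_K1 (path_graph 3) \<or> G \<simeq> H1 \<or> G \<simeq> H2 \<or> G \<simeq> H3 \<or> G \<simeq> H4"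
proof -
  interpret pair_graph G by fact
  have C: "pair_graph (cycle_graph 4)" "pair_graph (cycle_graph 5)" "pair_graph (cycle_graph 7)"
    by (simp_all add: pair_graph_cycle_graph)
  have "well_dominated G \<longleftrightarrow> (\<exists>T \<in> set targets. realises (pverts G) (adj G) T)"
    using well_dominated_imp_target[OF assms(2-4)] well_dominated_realises well_dominated_targets
    by (auto simp: list_all_iff)
  also have "\<dots> \<longleftrightarrow>
    G \<simeq> complete_graph 1 \<or> G \<simeq> complete_graph 2 \<or> G \<simeq> path_graph 4 \<or>
    G \<simeq> cycle_graph 4 \<or> G \<simeq> cycle_graph 5 \<or> G \<simeq> cycle_graph 7 \<or>
    G \<simeq> corona_K1 (path_graph 3) \<or> G \<simeq> H1 \<or> G \<simeq> H2 \<or> G \<simeq> H3 \<or> G \<simeq> H4"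
    \<comment> \<open>The targets stand in the order of the disjuncts, so replacing each isomorphism
      by its matrix makes both sides coincide.\<close>
    by (simp only: targets_def list.set bex_simps simp_thms
        isomorphic_iff_realises[OF assms(1) pair_graph_complete_graph realises_complete_graph(1)]
        isomorphic_iff_realises[OF assms(1) pair_graph_complete_graph realises_complete_graph(2)]
        isomorphic_iff_realises[OF assms(1) pair_graph_path_graph realises_path_graph_4]
        isomorphic_iff_realises[OF assms(1) C(1) realises_cycle_graph(1)]
        isomorphic_iff_realises[OF assms(1) C(2) realises_cycle_graph(2)]
        isomorphic_iff_realises[OF assms(1) C(3) realises_cycle_graph(3)]
        isomorphic_iff_realises[OF assms(1) pair_graph_corona_K1[OF pair_graph_path_graph] realises_corona]
        isomorphic_iff_realises[OF assms(1) pair_graph_H(1) realises_H(1)]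
        isomorphic_iff_realises[OF assms(1) pair_graph_H(2) realises_H(2)]
        isomorphic_iff_realises[OF assms(1) pair_graph_H(3) realises_H(3)]
        isomorphic_iff_realises[OF assms(1) pair_graph_H(4) realises_H(4)])
  finally show ?thesis .
qed

end
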